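(* Let $n\ge1$, fix $B\in\mathscr{S}_n(\mathbb{C}^+)$ and a unitary $n\times n$ matrix $\alpha$. Then for any $s\in\mathbb{R}$, $$\mu^{B\alpha^*}(\{s\})=\frac{2i}{\pi(1+s^2)^2}\lim_{w\downarrow s}(s-w)\,(I-B(w)\alpha^* )^{-1}.$$
   Context: $\mathbb{C}^+$ is the open upper half-plane, $\mathbb{D}$ the open unit disk, $\mathbb{T}$ the unit circle. For an open set $X\subset\mathbb{C}$, $\mathscr{S}_n(X)$ denotes the set of contractive $n\times n$ matrix-valued analytic functions on $X$. $\lim_{w\downarrow s}$ is the non-tangential limit as $w\in\mathbb{C}^+$ tends to $s\in\mathbb{R}$. The Cayley transform is $\gamma(w)=\frac{w-i}{w+i}$, a bijection of $\mathbb{C}^+$ onto $\mathbb{D}$ extending to a bijection of $\mathbb{R}$ onto $\mathbb{T}\setminus\{1\}$. Given $B\in\mathscr{S}_n(\mathbb{C}^+)$, let $b\in\mathscr{S}_n(\mathbb{D})$ be defined by $B(w)=b(\gamma(w))$. It is understood that $I-b(\zeta)\alpha^*$ is invertible for $\zeta\in\mathbb{D}$, so that the Clark measure is defined: $\mu^{b\alpha^*}$ is the unique nonnegative $n\times n$ matrix-valued Borel measure on $\mathbb{T}$ with $$\operatorname{Re}\big[(I-b(\zeta)\alpha^* )^{-1}(I+b(\zeta)\alpha^* )\big]=\int_{\mathbb{T}}\frac{1-|\zeta|^2}{|\lambda-\zeta|^2}\,\mu^{b\alpha^*}(d\lambda),\quad \zeta\in\mathbb{D},$$ where $\operatorname{Re}X=\frac12(X+X^*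 )$. The Clark measure on the line is normalized here by $$\mu^{B\alpha^*}(\Omega)=\int_\Omega\frac{1}{\pi(1+t^2)}\,(\mu^{b\alpha^*}\circ\gamma)(dt),\qquad \Omega\subseteq\mathbb{R}\ \text{Borel},$$ where $(\mu^{b\alpha^*}\circ\gamma)(\Omega)=\mu^{b\alpha^*}(\gamma(\Omega))$. *)

theory Defs
  imports "HOL-Analysis.Analysis"
begin

section \<open>Complex matrices\<close>

definition adj :: "complex^'n^'m \<Rightarrow> complex^'m^'n" where
  "adj A = map_matrix cnj (transpose A)"

definition unitary_mat :: "complex^'n^'n \<Rightarrow> bool" where
  "unitary_mat A \<longleftrightarrow> A ** adj A = mat 1 \<and> adj A ** A = mat 1"

definition re_mat :: "complex^'n^'n \<Rightarrow> complex^'n^'n" where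
  "re_mat A = (1/2) *\<^sub>R (A + adj A)"

definition cscale :: "complex \<Rightarrow> complex^'n^'m \<Rightarrow> complex^'n^'m" where
  "cscale c A = map_matrix ((*) c) A"

text \<open>The quadratic form \<open>v\<^sup>* A v\<close>.\<close>

definition qform :: "complex^'n^'n \<Rightarrow> complex^'n \<Rightarrow> complex" where
  "qform A v = (\<Sum>i\<in>UNIV. cnj (v $ i) * (A *v v) $ i)"

definition psd :: "complex^'n^'n \<Rightarrow> bool" where
  "psd A \<longleftrightarrow> (\<forall>v. qform A v \<in> \<real>\<^sub>\<ge>\<^sub>0)"


section \<open>Contractive analytic matrix functions\<close>

text \<open>The norm of the type of matrices is the Frobenius norm, so contractivity has to be
  stated with the operator norm.\<close>

definition schur_class :: "complex set \<Rightarrow> (complex \<Rightarrow> complex^'n^'n) set" where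
  "schur_class X = {F. (\<forall>i j. (\<lambda>z. F z $ i $ j) holomorphic_on X) \<and>
                       (\<forall>z\<in>X. onorm ((*v) (F z)) \<le> 1)}"


section \<open>The half-plane, the disk and non-tangential limits\<close>

definition upper_half_plane :: "complex set" where
  "upper_half_plane = {w. Im w > 0}"

definition cayley :: "complex \<Rightarrow> complex" where
  "cayley w = (w - \<i>) / (w + \<i>)"

definition disk_fun :: "(complex \<Rightarrow> 'a) \<Rightarrow> complex \<Rightarrow> 'a" where
  "disk_fun B = (\<lambda>\<zeta>. B (inv_into upper_half_plane cayley \<zeta>))"

definition stolz_sector :: "real \<Rightarrow> real \<Rightarrow> complex set" where
  "stolz_sector s \<kappa> = {w. Im w > 0 \<and> \<bar>Re w - s\<bar> < \<kappa> * Im w}"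

definition nontangential_limit ::
    "(complex \<Rightarrow> 'a::topological_space) \<Rightarrow> real \<Rightarrow> 'a \<Rightarrow> bool" where
  "nontangential_limit f s L \<longleftrightarrow>
     (\<forall>\<kappa>>0. (f \<longlongrightarrow> L) (at (complex_of_real s) within stolz_sector s \<kappa>))"


section \<open>Matrix-valued measures\<close>

text \<open>A nonnegative matrix-valued Borel measure on \<open>X\<close> is a countably additive function on the
  Borel subsets of \<open>X\<close>; its values on other sets are irrelevant. Additivity along
  the constant sequence \<open>{}\<close> forces \<open>\<mu> {} = 0\<close>.\<close>

definition psd_measure :: "'a::topological_space set \<Rightarrow> ('a set \<Rightarrow> complex^'n^'n) \<Rightarrow> bool" where
  "psd_measure X \<mu> \<longleftrightarrow>
     (\<forall>A\<in>sets (restrict_space borel X). psd (\<mu> A)) \<and>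
     (\<forall>A::nat \<Rightarrow> 'a set. range A \<subseteq> sets (restrict_space borel X) \<and> disjoint_family A
        \<longrightarrow> (\<lambda>k. \<mu> (A k)) sums \<mu> (\<Union>k. A k))"

text \<open>The finite positive measure \<open>A \<mapsto> v\<^sup>* \<mu>(A) v\<close>.\<close>

definition form_measure ::
    "'a::topological_space set \<Rightarrow> ('a set \<Rightarrow> complex^'n^'n) \<Rightarrow> complex^'n \<Rightarrow> 'a measure" where
  "form_measure X \<mu> v =
     measure_of X (sets (restrict_space borel X)) (\<lambda>A. ennreal (Re (qform (\<mu> A) v)))"

text \<open>The matrix \<open>\<integral> f d\<mu>\<close> has the entries \<open>\<integral> f d\<mu>\<^sub>i\<^sub>j\<close>. By polarization, the complex measure
  \<open>\<mu>\<^sub>i\<^sub>j\<close> is the combination \<open>1/4 \<Sum>k<4. (-\<i>)^k \<mu>\<^sub>v\<close> of the positive measures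
  \<open>\<mu>\<^sub>v = v\<^sup>* \<mu> v\<close> with \<open>v = e\<^sub>i + \<i>^k e\<^sub>j\<close>.\<close>

definition mat_integral ::
    "'a::topological_space set \<Rightarrow> ('a set \<Rightarrow> complex^'n^'n) \<Rightarrow> ('a \<Rightarrow> real) \<Rightarrow> complex^'n^'n" where
  "mat_integral X \<mu> f =
     (\<chi> i j. 1/4 * (\<Sum>k<4. (-\<i>)^k *
        complex_of_real (\<integral>x. f x \<partial>form_measure X \<mu> (axis i 1 + \<i>^k *s axis j 1))))"


section \<open>Clark measures\<close>

definition is_clark_measure ::
    "(complex \<Rightarrow> complex^'n^'n) \<Rightarrow> complex^'n^'n \<Rightarrow> (complex set \<Rightarrow> complex^'n^'n) \<Rightarrow> bool" where
  "is_clark_measure b \<alpha> \<mu> \<longleftrightarrow>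
     psd_measure (sphere 0 1) \<mu> \<and>
     (\<forall>\<zeta>\<in>ball 0 1.
        re_mat (matrix_inv (mat 1 - b \<zeta> ** adj \<alpha>) ** (mat 1 + b \<zeta> ** adj \<alpha>))
        = mat_integral (sphere 0 1) \<mu> (\<lambda>z. (1 - (norm \<zeta>)\<^sup>2) / (norm (z - \<zeta>))\<^sup>2))"

definition line_clark_measure ::
    "(complex set \<Rightarrow> complex^'n^'n) \<Rightarrow> real set \<Rightarrow> complex^'n^'n" where
  "line_clark_measure \<mu> \<Omega> =
     mat_integral UNIV (\<lambda>A. \<mu> (cayley ` complex_of_real ` A))
       (\<lambda>t. indicator \<Omega> t * (1 / (pi * (1 + t\<^sup>2))))"

end

theory Submission
  imports Defs
begin

text \<open>
  Write \<open>H = (I - b\<alpha>\<^sup>*)\<^sup>-\<^sup>1(I + b\<alpha>\<^sup>*) = 2(I - b\<alpha>\<^sup>*)\<^sup>-\<^sup>1 - I\<close> and let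
  \<open>G(\<zeta>) = \<integral> (\<lambda> + \<zeta>)/(\<lambda> - \<zeta>) \<mu>(d\<lambda>)\<close>. Both are analytic on the disk and have the same real part
  there, so \<open>H - G\<close> is constant. Since the factor \<open>s - w\<close> kills constants, the limit in question is
  that of \<open>(s - w) G(\<gamma>(w))/2\<close>. In a Stolz sector the integrand \<open>(s - w)(\<lambda> + \<gamma>(w))/(\<lambda> - \<gamma>(w))\<close> is
  bounded uniformly in \<open>\<lambda>\<close>, tends to \<open>0\<close> for \<open>\<lambda> \<noteq> \<gamma>(s)\<close> and to \<open>-\<i>(1 + s\<^sup>2)\<close> for \<open>\<lambda> = \<gamma>(s)\<close>;
  dominated convergence applies.
\<close>

section \<open>Matrices\<close>

lemma matrix_vector_mult_axis_nth: "(A *v axis i 1) $ k = A $ k $ i"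
  for A :: "'a::semiring_1^'n^'m"
proof -
  have "A $ k $ l * axis i 1 $ l = (if l = i then A $ k $ l else 0)" for l
    by (simp add: axis_def)
  then show ?thesis by (simp add: matrix_vector_mult_def)
qed

lemma qform_polarization_vector:
  "qform A (axis i 1 + c *s axis j 1)
     = A $ i $ i + c * A $ i $ j + cnj c * A $ j $ i + cnj c * c * A $ j $ j"
proof -
  have 1: "(A *v (axis i 1 + c *s axis j 1)) $ k = A $ k $ i + c * A $ k $ j" for k
    by (simp add: matrix_vector_right_distrib vector_scalar_commute
        matrix_vector_mult_axis_nth)
  have 2: "(\<Sum>k\<in>UNIV. cnj ((axis i 1 + c *s axis j 1) $ k) * x k) = x i + cnj c * x j"
    for x :: "_ \<Rightarrow> complex"
  proof -
    have "cnj ((axis i 1 + c *s axis j 1) $ k) * x k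
        = (if k = i then x k else 0) + (if k = j then cnj c * x k else 0)" for k
      by (simp add: axis_def algebra_simps)
    then show ?thesis by (simp add: sum.distrib)
  qed
  show ?thesis
    unfolding qform_def 1 2 by (simp add: algebra_simps)
qed

lemma sum_lessThan_4: "(\<Sum>k<4. f k) = f 0 + f 1 + f 2 + f (3::nat)"
  by (simp add: eval_nat_numeral)

text \<open>Put \<open>c = \<i>^k\<close> in the expansion above. After weighting by
  \<open>(-\<i>)^k\<close>, the coefficient of \<open>A $ i $ j\<close> is 1 for every
  \<open>k\<close>, whereas the diagonal terms carry \<open>(-\<i>)^k\<close> and
  \<open>A $ j $ i\<close> carries \<open>(-1)^k\<close>; both of these sum to 0 over
  \<open>k < 4\<close>.\<close>

lemma qform_polarization:
  "1/4 * (\<Sum>k<4. (-\<i>)^k * qform A (axis i 1 + \<i>^k *s axis j 1)) = A $ i $ j"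
  by (simp add: sum_lessThan_4 qform_polarization_vector power3_eq_cube power2_eq_square algebra_simps)

text \<open>The factors \<open>c\<close> and \<open>cnj c\<close> cancel. This later identifies the
  scalar measures that polarization attaches to the index pairs \<open>(i, j)\<close> and
  \<open>(j, i)\<close>.\<close>

lemma qform_scale:
  assumes "norm c = 1"
  shows "qform A (c *s v) = qform A v"
proof -
  have "cnj c * c = 1"
    using assms complex_norm_square[of c] by (simp add: mult.commute)
  then have "cnj (c * x) * (c * y) = cnj x * y" for x y
    by (metis complex_cnj_mult mult.assoc mult.left_commute mult_1)
  then show ?thesis
    unfolding qform_def vector_scalar_commute vector_smult_component by presburger
qed

lemma psd_qform: "psd A \<Longrightarrow> complex_of_real (Re (qform A v)) = qform A v"
  and psd_qform_nonneg: "psd A \<Longrightarrow> 0 \<le> Re (qform A v)"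
  unfolding psd_def by (auto simp: complex_nonneg_Reals_iff complex_eq_iff)

lemma bounded_linear_qform: "bounded_linear (\<lambda>A. qform A v)"
proof -
  have "bounded_linear (\<lambda>A. \<Sum>i\<in>UNIV. cnj (v $ i) * (\<Sum>j\<in>UNIV. A $ i $ j * v $ j))"
    by (intro bounded_linear_sum bounded_linear_const_mult bounded_linear_mult_const
        bounded_linear_compose[OF bounded_linear_vec_nth] bounded_linear_vec_nth)
  then show ?thesis by (simp add: qform_def[abs_def] matrix_vector_mult_def)
qed

lemma adj_nth: "adj A $ i $ j = cnj (A $ j $ i)"
  by (simp add: adj_def transpose_def map_matrix_def)

lemma cscale_nth: "cscale c A $ i $ j = c * A $ i $ j"
  by (simp add: cscale_def map_matrix_def)

lemma re_mat_nth: "re_mat A $ i $ j = (A $ i $ j + cnj (A $ j $ i)) / 2"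
  by (simp add: re_mat_def adj_nth scaleR_conv_of_real[where 'a = complex])

lemma tendsto_matrixI:
  fixes f :: "_ \<Rightarrow> 'a::topological_space^'n^'m"
  assumes "\<And>i j. ((\<lambda>w. f w $ i $ j) \<longlongrightarrow> L $ i $ j) F"
  shows "(f \<longlongrightarrow> L) F"
  using assms by (intro vec_tendstoI)

text \<open>Since \<open>(1 + A) + (1 - A) = 2\<close>, multiplying by the inverse of
  \<open>1 - A\<close> leaves twice that inverse minus the identity. The function in the definition
  of the Clark measure is thereby affine in the resolvent.\<close>

lemma matrix_inv_Cayley:
  fixes A :: "complex^'n^'n"
  assumes "invertible (mat 1 - A)"
  shows "(matrix_inv (mat 1 - A) ** (mat 1 + A)) $ i $ j
    = 2 * matrix_inv (mat 1 - A) $ i $ j - mat 1 $ i $ j"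
proof -
  let ?V = "matrix_inv (mat 1 - A)"
  have "?V ** (mat 1 - A) = mat 1"
    using assms unfolding invertible_def matrix_inv_def by (rule someI2_ex) blast
  moreover have "?V ** (mat 1 + A) + ?V ** (mat 1 - A) = ?V + ?V"
  proof -
    have "mat 1 + A + (mat 1 - A) = mat 1 + mat 1" by (simp add: vec_eq_iff)
    then show ?thesis by (metis matrix_add_ldistrib matrix_mul_rid)
  qed
  ultimately have "?V ** (mat 1 + A) = ?V + ?V - mat 1"
    by (simp add: eq_diff_eq)
  then show ?thesis by simp
qed

section \<open>Analytic dependence of the inverse matrix\<close>

text \<open>Cramer's rule for the system whose right-hand side is the \<open>l\<close>-th unit
  vector. Entries of the inverse become quotients of polynomials in the entries of \<open>A\<close>,
  from which holomorphy can be read off.\<close>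

lemma matrix_inv_nth_eq_det:
  fixes A :: "complex^'n^'n"
  assumes "invertible A"
  shows "matrix_inv A $ k $ l = det (\<chi> i j. if j = k then axis l 1 $ i else A $ i $ j) / det A"
proof -
  have "A ** matrix_inv A = mat 1"
    using assms unfolding invertible_def matrix_inv_def by (rule someI2_ex) blast
  then have "A *v (matrix_inv A *v axis l 1) = axis l 1"
    by (simp add: matrix_vector_mul_assoc)
  then have "matrix_inv A *v axis l 1
      = (\<chi> k. det (\<chi> i j. if j = k then axis l 1 $ i else A $ i $ j) / det A)"
    using assms by (subst (asm) cramer) (auto simp: invertible_det_nz)
  then show ?thesis
    by (simp add: matrix_vector_mult_axis_nth[symmetric])
qed

lemma holomorphic_on_det:
  assumes "\<And>i j. (\<lambda>z. A z $ i $ j) holomorphic_on S"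
  shows "(\<lambda>z. det (A z :: complex^'n^'n)) holomorphic_on S"
  unfolding det_def by (intro holomorphic_intros assms)

lemma holomorphic_on_matrix_inv:
  fixes A :: "complex \<Rightarrow> complex^'n^'n"
  assumes "\<And>i j. (\<lambda>z. A z $ i $ j) holomorphic_on S" and "\<And>z. z \<in> S \<Longrightarrow> invertible (A z)"
  shows "(\<lambda>z. matrix_inv (A z) $ k $ l) holomorphic_on S"
proof -
  have "(\<lambda>z. (\<chi> i j. if j = k then axis l 1 $ i else A z $ i $ j) $ a $ b) holomorphic_on S" for a b
    using assms(1) by (cases "b = k") auto
  then have "(\<lambda>z. det (\<chi> i j. if j = k then axis l 1 $ i else A z $ i $ j) / det (A z)) holomorphic_on S"
    using assms by (intro holomorphic_on_divide holomorphic_on_det) (auto simp: invertible_det_nz)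
  then show ?thesis
    by (rule holomorphic_transform) (simp add: matrix_inv_nth_eq_det assms)
qed

lemma holomorphic_on_matrix_mult_const:
  fixes A :: "complex \<Rightarrow> complex^'n^'m" and C :: "complex^'k^'n"
  assumes "\<And>i j. (\<lambda>z. A z $ i $ j) holomorphic_on S"
  shows "(\<lambda>z. (A z ** C) $ i $ j) holomorphic_on S"
  unfolding matrix_matrix_mult_def by (simp, intro holomorphic_intros assms)


section \<open>Analytic functions with vanishing real part\<close>

text \<open>If \<open>d\<close> is the derivative at a point, the real part has derivative
  \<open>h \<mapsto> Re (d * h)\<close>, which must vanish. The directions \<open>h = 1\<close> and
  \<open>h = \<i>\<close> give \<open>Re d = 0\<close> and \<open>Im d = 0\<close>, and a zero
  derivative on a convex set forces constancy.\<close>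

lemma holomorphic_Re_0_imp_constant:
  assumes "f holomorphic_on S" "open S" "convex S" "\<And>z. z \<in> S \<Longrightarrow> Re (f z) = 0"
  shows "\<exists>c. \<forall>z\<in>S. f z = c"
proof (rule has_field_derivative_zero_constant[OF \<open>convex S\<close>])
  fix z assume z: "z \<in> S"
  obtain d where d: "(f has_field_derivative d) (at z)"
    using assms z by (metis at_within_open field_differentiable_def holomorphic_on_def)
  have "((\<lambda>w. Re (f w)) has_derivative (\<lambda>h. Re (d * h))) (at z)"
    using bounded_linear.has_derivative[OF bounded_linear_Re d[unfolded has_field_derivative_def]] .
  moreover have "((\<lambda>w. Re (f w)) has_derivative (\<lambda>h. 0)) (at z)"
    by (rule has_derivative_transform_within_open[OF has_derivative_const[of 0] \<open>open S\<close> z])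
       (simp add: assms)
  ultimately have "(\<lambda>h. Re (d * h)) = (\<lambda>h. 0)"
    by (rule has_derivative_unique)
  from fun_cong[OF this, of 1] fun_cong[OF this, of \<i>] have "d = 0"
    by (simp add: complex_eq_iff)
  with d show "(f has_field_derivative 0) (at z within S)"
    using has_field_derivative_at_within by blast
qed

text \<open>The hypothesis couples the \<open>(i, j)\<close> entry to the conjugate of the
  \<open>(j, i)\<close> entry, which is not holomorphic. The sum of the two entries and
  \<open>\<i>\<close> times their difference are holomorphic, however, and have real part 0, so the
  scalar case applies to both; the entries are recovered from these combinations.\<close>

lemma re_mat_0_imp_constant:
  fixes F :: "complex \<Rightarrow> complex^'n^'n"
  assumes holo: "\<And>i j. (\<lambda>z. F z $ i $ j) holomorphic_on S" and S: "open S" "convex S"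
    and re: "\<And>z. z \<in> S \<Longrightarrow> re_mat (F z) = 0"
  shows "\<exists>C. \<forall>z\<in>S. F z = C"
proof -
  have sym: "F z $ i $ j + cnj (F z $ j $ i) = 0" if "z \<in> S" for z i j
    using arg_cong[OF re[OF that], of "\<lambda>A. A $ i $ j"] by (simp add: re_mat_nth)
  have "\<exists>c. \<forall>z\<in>S. F z $ i $ j = c" for i j
  proof -
    have "\<exists>c. \<forall>z\<in>S. F z $ i $ j + F z $ j $ i = c"
    proof (rule holomorphic_Re_0_imp_constant[OF _ S])
      show "Re (F z $ i $ j + F z $ j $ i) = 0" if "z \<in> S" for z
        using sym[OF that, of i j] by (simp add: complex_eq_iff)
    qed (intro holomorphic_intros holo)
    moreover have "\<exists>c. \<forall>z\<in>S. \<i> * (F z $ i $ j - F z $ j $ i) = c"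
    proof (rule holomorphic_Re_0_imp_constant[OF _ S])
      show "Re (\<i> * (F z $ i $ j - F z $ j $ i)) = 0" if "z \<in> S" for z
        using sym[OF that, of i j] by (simp add: complex_eq_iff)
    qed (intro holomorphic_intros holo)
    ultimately obtain c d where
      cd: "\<forall>z\<in>S. F z $ i $ j + F z $ j $ i = c" "\<forall>z\<in>S. \<i> * (F z $ i $ j - F z $ j $ i) = d"
      by blast
    have "F z $ i $ j = (c - \<i> * d) / 2" if "z \<in> S" for z
    proof -
      have "c = F z $ i $ j + F z $ j $ i" "d = \<i> * (F z $ i $ j - F z $ j $ i)"
        using cd that by auto
      then show ?thesis by (simp add: mult.assoc[symmetric])
    qed
    then show ?thesis by blast
  qed
  then obtain c where "\<And>i j z. z \<in> S \<Longrightarrow> F z $ i $ j = c i j" by metis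
  then have "\<forall>z\<in>S. F z = (\<chi> i j. c i j)" by (simp add: vec_eq_iff)
  then show ?thesis by blast
qed


section \<open>Matrix-valued measures\<close>

lemma space_form_measure [simp]: "space (form_measure X \<mu> v) = X"
  and sets_form_measure: "sets (form_measure X \<mu> v) = sets (restrict_space borel X)"
proof -
  have sub: "sets (restrict_space borel X) \<subseteq> Pow X"
    using sets.space_closed[of "restrict_space borel X"] by (simp add: space_restrict_space)
  show "space (form_measure X \<mu> v) = X"
    unfolding form_measure_def by (rule space_measure_of[OF sub])
  show "sets (form_measure X \<mu> v) = sets (restrict_space borel X)"
    unfolding form_measure_def sets_measure_of[OF sub]
    using sets.sigma_sets_eq[of "restrict_space borel X"] by (simp add: space_restrict_space)
qed

lemma measurable_form_measure [measurable]:
  "f \<in> borel_measurable borel \<Longrightarrow> f \<in> borel_measurable (form_measure X \<mu> v)"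
  using measurable_restrict_space1 measurable_cong_sets[OF sets_form_measure refl] by blast

text \<open>\<open>measure_of\<close> returns the given set function only once it is known to be
  positive and countably additive. Positivity comes from \<open>psd\<close>; additivity follows by
  applying the bounded linear functional \<open>Re (qform _ v)\<close> to the convergent matrix
  series.\<close>

lemma emeasure_form_measure:
  fixes X :: "'a::topological_space set"
  assumes \<mu>: "psd_measure X \<mu>" and A: "A \<in> sets (restrict_space borel X)"
  shows "emeasure (form_measure X \<mu> v) A = ennreal (Re (qform (\<mu> A) v))"
proof -
  let ?S = "sets (restrict_space borel X)"
  have pos: "0 \<le> Re (qform (\<mu> A) v)" if "A \<in> ?S" for A
    using \<mu> that by (simp add: psd_measure_def psd_qform_nonneg)
  have sums: "(\<lambda>k. Re (qform (\<mu> (A k)) v)) sums Re (qform (\<mu> (\<Union>k. A k)) v)"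
    if "range A \<subseteq> ?S" "disjoint_family A" for A :: "nat \<Rightarrow> _"
  proof -
    have "(\<lambda>k. \<mu> (A k)) sums \<mu> (\<Union>k. A k)"
      using \<mu> that unfolding psd_measure_def by blast
    then show ?thesis
      by (rule bounded_linear.sums[OF bounded_linear_compose[OF bounded_linear_Re bounded_linear_qform]])
  qed
  \<comment> \<open>A convergent series has terms tending to 0; for the constant sequence of empty
    sets this gives \<open>\<mu> {} = 0\<close>.\<close>
  have "(\<lambda>k::nat. \<mu> {}) sums \<mu> (\<Union>k::nat. {})"
  proof -
    have "range (\<lambda>k::nat. {}) \<subseteq> ?S \<and> disjoint_family (\<lambda>k::nat. {} :: 'a set)"
      by (auto simp: disjoint_family_on_def)
    then show ?thesis
      using \<mu> unfolding psd_measure_def by blast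
  qed
  then have "(\<lambda>k::nat. \<mu> {}) sums \<mu> {}"
    by simp
  then have empty: "\<mu> {} = 0"
    using summable_LIMSEQ_zero[OF sums_summable] LIMSEQ_const_iff by blast
  show ?thesis
  proof (rule emeasure_measure_of[OF form_measure_def])
    show "?S \<subseteq> Pow X" using sets.space_closed[of "restrict_space borel X"] by (simp add: space_restrict_space)
    show "positive (sets (form_measure X \<mu> v)) (\<lambda>A. ennreal (Re (qform (\<mu> A) v)))"
      by (simp add: positive_def empty linear_0[OF bounded_linear.linear[OF bounded_linear_qform]])
    show "countably_additive (sets (form_measure X \<mu> v)) (\<lambda>A. ennreal (Re (qform (\<mu> A) v)))"
      unfolding sets_form_measure countably_additive_def
      by (auto intro!: suminf_ennreal_eq sums pos)
  qed (use A in \<open>simp_all add: sets_form_measure\<close>)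
qed

lemma finite_measure_form_measure:
  assumes "psd_measure X \<mu>" shows "finite_measure (form_measure X \<mu> v)"
proof (rule finite_measureI)
  have "X \<in> sets (restrict_space borel X)"
    using sets.top[of "restrict_space borel X"] by (simp add: space_restrict_space)
  then show "emeasure (form_measure X \<mu> v) (space (form_measure X \<mu> v)) \<noteq> \<infinity>"
    by (simp add: emeasure_form_measure[OF assms])
qed

lemma singleton_in_sets_restrict_borel:
  "x \<in> X \<Longrightarrow> {x} \<in> sets (restrict_space borel X)" for x :: "'a::t1_space"
  unfolding sets_restrict_space by (rule image_eqI[of _ _ "{x}"]) auto

lemma measure_form_measure_singleton:
  fixes x :: "'a::t1_space"
  assumes "psd_measure X \<mu>" "x \<in> X"
  shows "complex_of_real (measure (form_measure X \<mu> v) {x}) = qform (\<mu> {x}) v"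
proof -
  have "psd (\<mu> {x})"
    using assms singleton_in_sets_restrict_borel unfolding psd_measure_def by blast
  then show ?thesis
    by (simp add: measure_def emeasure_form_measure assms singleton_in_sets_restrict_borel
        psd_qform psd_qform_nonneg)
qed

text \<open>Against each polarization measure the integrand contributes \<open>g x\<close> times the
  point mass at \<open>x\<close>, and polarization of \<open>\<mu> {x}\<close> reassembles the
  matrix entry.\<close>

lemma mat_integral_singleton:
  fixes x :: "'a::t1_space"
  assumes \<mu>: "psd_measure X \<mu>" "x \<in> X"
  shows "mat_integral X \<mu> (\<lambda>t. indicator {x} t * g t) $ i $ j = g x * \<mu> {x} $ i $ j"
proof -
  have "(\<integral>t. indicator {x} t * g t \<partial>form_measure X \<mu> v) = g x * measure (form_measure X \<mu> v) {x}" for v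
  proof -
    have "(\<integral>t. indicator {x} t * g t \<partial>form_measure X \<mu> v)
        = (\<integral>t. indicator {x} t * g x \<partial>form_measure X \<mu> v)"
      by (intro Bochner_Integration.integral_cong) (auto split: split_indicator)
    then show ?thesis
      using \<mu> by (simp add: mult.commute Int_absorb2)
  qed
  then show ?thesis
    unfolding qform_polarization[symmetric, of "\<mu> {x}"]
    by (simp add: mat_integral_def measure_form_measure_singleton[OF \<mu>] sum_distrib_left mult_ac)
qed

section \<open>Complex integrands and bounded convergence\<close>

text \<open>The polarization formula of \<open>mat_integral\<close>, extended to complex integrands
  because the Herglotz kernel is not real.\<close>

definition complex_mat_integral ::
    "'a::topological_space set \<Rightarrow> ('a set \<Rightarrow> complex^'n^'n) \<Rightarrow> ('a \<Rightarrow> complex) \<Rightarrow> complex^'n^'n" where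
  "complex_mat_integral X \<mu> f =
     (\<chi> i j. 1/4 * (\<Sum>k<4. (-\<i>)^k *
        (\<integral>x. f x \<partial>form_measure X \<mu> (axis i 1 + \<i>^k *s axis j 1))))"

lemma form_measure_scale: "norm c = 1 \<Longrightarrow> form_measure X \<mu> (c *s v) = form_measure X \<mu> v"
  unfolding form_measure_def by (simp add: qform_scale)

text \<open>The adjoint swaps \<open>i\<close> and \<open>j\<close> and conjugates. The swap
  permutes the four polarization measures by \<open>k \<mapsto> -k\<close> modulo 4, and conjugation
  permutes the weights \<open>(-\<i>)^k\<close> in the same way. So each integral is averaged with
  its own conjugate, which leaves its real part.\<close>

lemma re_mat_complex_mat_integral:
  assumes int: "\<And>v. integrable (form_measure X \<mu> v) f"
  shows "re_mat (complex_mat_integral X \<mu> f) = mat_integral X \<mu> (\<lambda>x. Re (f x))"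
proof -
  define M where "M k i j = form_measure X \<mu> (axis i 1 + \<i>^k *s axis j 1)" for k i j
  have swap: "M k j i = M l i j" if "\<i>^k * \<i>^l = 1" for k l i j
  proof -
    have "axis j 1 + \<i>^k *s axis i 1 = \<i>^k *s (axis i 1 + \<i>^l *s axis j 1)"
      unfolding vector_add_ldistrib vector_smult_assoc that by (simp add: add.commute)
    then show ?thesis unfolding M_def by (simp only: form_measure_scale norm_power norm_ii power_one)
  qed
  have Re: "(\<integral>x. Re (f x) \<partial>M k i j) = Re (\<integral>x. f x \<partial>M k i j)" for k i j
    unfolding M_def using int by (intro integral_Re)
  have "re_mat (complex_mat_integral X \<mu> f) $ i $ j = mat_integral X \<mu> (\<lambda>x. Re (f x)) $ i $ j" for i j
  proof -
    \<comment> \<open>These are the index pairs with \<open>\<i>^k * \<i>^l = 1\<close>, where the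
      two polarization vectors differ by a unimodular factor.\<close>
    have M: "M 0 j i = M 0 i j" "M 1 j i = M 3 i j" "M 2 j i = M 2 i j" "M 3 j i = M 1 i j"
      by (rule swap, simp add: eval_nat_numeral)+
    show ?thesis
      unfolding re_mat_nth mat_integral_def complex_mat_integral_def vec_lambda_beta
        M_def[symmetric] Re sum_lessThan_4 M
      by (simp add: complex_eq_iff power3_eq_cube field_simps)
  qed
  then show ?thesis by (simp add: vec_eq_iff)
qed

text \<open>Dominated convergence is a statement about sequences, and a limit within
  \<open>S\<close> can be tested on sequences in a first countable space. The constant
  \<open>C\<close> is an integrable majorant because the measure is finite.\<close>

lemma (in finite_measure) integral_tendsto_bounded:
  fixes f :: "'b::first_countable_topology \<Rightarrow> 'a \<Rightarrow> 'c::{banach,second_countable_topology}"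
  assumes [measurable]: "\<And>w. f w \<in> borel_measurable M" "g \<in> borel_measurable M"
    and bound: "\<forall>\<^sub>F w in at a within S. \<forall>x\<in>space M. norm (f w x) \<le> C"
    and lim: "\<And>x. x \<in> space M \<Longrightarrow> ((\<lambda>w. f w x) \<longlongrightarrow> g x) (at a within S)"
  shows "((\<lambda>w. \<integral>x. f w x \<partial>M) \<longlongrightarrow> (\<integral>x. g x \<partial>M)) (at a within S)"
  unfolding tendsto_at_iff_sequentially
proof (intro allI impI)
  fix X assume X: "\<forall>i. X i \<in> S - {a}" "X \<longlonglongrightarrow> a"
  then have fl: "filterlim X (at a within S) sequentially"
    by (simp add: filterlim_at)
  \<comment> \<open>The bound holds only from some index on, so the sequence is shifted by
    \<open>N\<close>; the shift does not affect the limit.\<close>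
  obtain N where N: "\<And>n x. n \<ge> N \<Longrightarrow> x \<in> space M \<Longrightarrow> norm (f (X n) x) \<le> C"
    using eventually_compose_filterlim[OF bound fl] by (auto simp: eventually_sequentially)
  have "(\<lambda>n. \<integral>x. f (X (n + N)) x \<partial>M) \<longlonglongrightarrow> (\<integral>x. g x \<partial>M)"
  proof (rule integral_dominated_convergence[where w = "\<lambda>_. C"])
    show "AE x in M. (\<lambda>n. f (X (n + N)) x) \<longlonglongrightarrow> g x"
    proof (rule AE_I2)
      fix x assume "x \<in> space M"
      then have "(\<lambda>n. f (X n) x) \<longlonglongrightarrow> g x"
        by (rule filterlim_compose[OF lim fl])
      then show "(\<lambda>n. f (X (n + N)) x) \<longlonglongrightarrow> g x"
        by (rule LIMSEQ_ignore_initial_segment)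
    qed
    show "AE x in M. norm (f (X (n + N)) x) \<le> C" for n
      by (intro AE_I2 N) auto
  qed (rule assms integrable_const)+
  then show "((\<lambda>w. \<integral>x. f w x \<partial>M) \<circ> X) \<longlonglongrightarrow> (\<integral>x. g x \<partial>M)"
    unfolding o_def by (rule LIMSEQ_offset[where k = N])
qed


section \<open>The Herglotz kernel\<close>

lemma sphere_dist_ge:
  fixes z \<zeta> :: complex assumes "norm z = 1" shows "1 - norm \<zeta> \<le> norm (z - \<zeta>)"
  using norm_triangle_ineq2[of z \<zeta>] assms by simp

text \<open>Multiply numerator and denominator by \<open>cnj (z - \<zeta>)\<close>: the real part of
  the new numerator is the difference of the squared norms, with \<open>norm z = 1\<close>. The
  result is the Poisson kernel.\<close>

lemma Re_herglotz_kernel: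
  assumes "norm z = 1"
  shows "Re ((z + \<zeta>) / (z - \<zeta>)) = (1 - (norm \<zeta>)\<^sup>2) / (norm (z - \<zeta>))\<^sup>2"
proof -
  have "(Re z)\<^sup>2 + (Im z)\<^sup>2 = 1"
    using assms by (simp add: cmod_def)
  then have "Re ((z + \<zeta>) * cnj (z - \<zeta>)) = 1 - (norm \<zeta>)\<^sup>2"
    unfolding cmod_power2 by (simp add: power2_eq_square algebra_simps)
  moreover have "(z + \<zeta>) / (z - \<zeta>) = ((z + \<zeta>) * cnj (z - \<zeta>)) / of_real ((norm (z - \<zeta>))\<^sup>2)"
    by (rule complex_div_cnj)
  ultimately show ?thesis
    by (metis Re_divide_of_real)
qed

lemma norm_herglotz_kernel_le:
  fixes z \<zeta> :: complex
  assumes "norm z = 1" "norm \<zeta> < 1"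
  shows "norm ((z + \<zeta>) / (z - \<zeta>)) \<le> 2 / (1 - norm \<zeta>)"
  unfolding norm_divide
  using sphere_dist_ge[of z \<zeta>] norm_triangle_ineq[of z \<zeta>] assms by (intro frac_le) auto

lemma integrable_herglotz_kernel:
  fixes \<zeta> :: complex
  assumes "psd_measure (sphere 0 1) \<mu>" "norm \<zeta> < 1"
  shows "integrable (form_measure (sphere 0 1) \<mu> v) (\<lambda>z. (z + \<zeta>) / (z - \<zeta>))"
proof (rule finite_measure.integrable_const_bound[where B = "2 / (1 - norm \<zeta>)"])
  show "finite_measure (form_measure (sphere 0 1) \<mu> v)"
    by (rule finite_measure_form_measure[OF assms(1)])
  show "AE z in form_measure (sphere 0 1) \<mu> v. norm ((z + \<zeta>) / (z - \<zeta>)) \<le> 2 / (1 - norm \<zeta>)"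
    by (intro AE_I2 norm_herglotz_kernel_le assms) simp
qed measurable

text \<open>An analytic completion of the Poisson integral that characterizes the Clark
  measure.\<close>

definition herglotz :: "(complex set \<Rightarrow> complex^'n^'n) \<Rightarrow> complex \<Rightarrow> complex^'n^'n" where
  "herglotz \<mu> \<zeta> = complex_mat_integral (sphere 0 1) \<mu> (\<lambda>z. (z + \<zeta>) / (z - \<zeta>))"

lemma re_mat_herglotz:
  assumes "psd_measure (sphere 0 1) \<mu>" "norm \<zeta> < 1"
  shows "re_mat (herglotz \<mu> \<zeta>)
    = mat_integral (sphere 0 1) \<mu> (\<lambda>z. (1 - (norm \<zeta>)\<^sup>2) / (norm (z - \<zeta>))\<^sup>2)"
proof -
  have "(\<integral>z. Re ((z + \<zeta>) / (z - \<zeta>)) \<partial>form_measure (sphere 0 1) \<mu> v)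
      = (\<integral>z. (1 - (norm \<zeta>)\<^sup>2) / (norm (z - \<zeta>))\<^sup>2 \<partial>form_measure (sphere 0 1) \<mu> v)" for v
    by (intro Bochner_Integration.integral_cong refl Re_herglotz_kernel) simp
  then show ?thesis
    unfolding herglotz_def re_mat_complex_mat_integral[OF integrable_herglotz_kernel[OF assms]]
      mat_integral_def by simp
qed

text \<open>Differentiation under the integral sign. The difference quotient of the kernel between
  \<open>x\<close> and \<open>y\<close> is exactly \<open>2 * z / ((z - y) * (z - x))\<close>, which
  is bounded uniformly in \<open>z\<close> for \<open>y\<close> near \<open>x\<close>, so bounded
  convergence yields the derivative.\<close>

lemma holomorphic_on_herglotz_integral:
  assumes \<mu>: "psd_measure (sphere 0 1) \<mu>"
  shows "(\<lambda>\<zeta>. \<integral>z. (z + \<zeta>) / (z - \<zeta>) \<partial>form_measure (sphere 0 1) \<mu> v) holomorphic_on ball 0 1"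
proof -
  let ?M = "form_measure (sphere 0 1) \<mu> v"
  interpret finite_measure ?M
    by (rule finite_measure_form_measure[OF \<mu>])
  let ?f = "\<lambda>\<zeta>. \<integral>z. (z + \<zeta>) / (z - \<zeta>) \<partial>?M"
  have "(?f has_field_derivative (\<integral>z. 2 * z / ((z - x) * (z - x)) \<partial>?M)) (at x within ball 0 1)"
    if x: "x \<in> ball 0 1" for x
  proof -
    have "((\<lambda>y. \<integral>z. 2 * z / ((z - y) * (z - x)) \<partial>?M) \<longlongrightarrow> (\<integral>z. 2 * z / ((z - x) * (z - x)) \<partial>?M))
      (at x within ball 0 1)"
    proof (rule integral_tendsto_bounded)
      \<comment> \<open>Half the distance from \<open>x\<close> to the circle: any \<open>y\<close>
        closer than this to \<open>x\<close> still has distance at least \<open>?r\<close> from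
        every point of the circle.\<close>
      let ?r = "(1 - norm x) / 2"
      have r: "?r > 0" using x by simp
      have "\<forall>\<^sub>F y in at x within ball 0 1. dist y x < ?r"
        using r tendstoD[OF tendsto_ident_at] by blast
      then show "\<forall>\<^sub>F y in at x within ball 0 1. \<forall>z\<in>space ?M.
          norm (2 * z / ((z - y) * (z - x))) \<le> 2 / (?r * ?r)"
      proof eventually_elim
        fix y assume y: "dist y x < ?r"
        show "\<forall>z\<in>space ?M. norm (2 * z / ((z - y) * (z - x))) \<le> 2 / (?r * ?r)"
        proof
          fix z assume "z \<in> space ?M"
          then have z: "norm z = 1" by simp
          have "norm y \<le> norm x + dist y x"
            using norm_triangle_ineq2[of y x] by (simp add: dist_norm)
          then have "?r \<le> norm (z - y)" using sphere_dist_ge[OF z, of y] y by (simp add: field_simps)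
          moreover have "?r \<le> norm (z - x)" using sphere_dist_ge[OF z, of x] r by simp
          ultimately have "?r * ?r \<le> norm (z - y) * norm (z - x)"
            using r by (intro mult_mono) auto
          then show "norm (2 * z / ((z - y) * (z - x))) \<le> 2 / (?r * ?r)"
            unfolding norm_divide norm_mult using z r by (intro frac_le) auto
        qed
      qed
      show "((\<lambda>y. 2 * z / ((z - y) * (z - x))) \<longlongrightarrow> 2 * z / ((z - x) * (z - x))) (at x within ball 0 1)"
        if "z \<in> space ?M" for z
        using that x by (intro tendsto_intros) auto
    qed measurable
    moreover have "\<forall>\<^sub>F y in at x within ball 0 1.
        (\<integral>z. 2 * z / ((z - y) * (z - x)) \<partial>?M) = (?f y - ?f x) / (y - x)"
      unfolding eventually_at_filter
    proof (intro always_eventually allI impI)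
      fix y assume y: "y \<noteq> x" "y \<in> ball 0 1"
      have "?f y - ?f x = (\<integral>z. (z + y) / (z - y) - (z + x) / (z - x) \<partial>?M)"
        using x y by (intro Bochner_Integration.integral_diff[symmetric] integrable_herglotz_kernel \<mu>) auto
      also have "\<dots> = (\<integral>z. (y - x) * (2 * z / ((z - y) * (z - x))) \<partial>?M)"
      proof (rule Bochner_Integration.integral_cong[OF refl])
        fix z assume "z \<in> space ?M"
        then have "z - y \<noteq> 0" "z - x \<noteq> 0" using x y by auto
        then show "(z + y) / (z - y) - (z + x) / (z - x) = (y - x) * (2 * z / ((z - y) * (z - x)))"
          by (simp add: divide_simps) (simp add: algebra_simps)
      qed
      also have "\<dots> = (y - x) * (\<integral>z. 2 * z / ((z - y) * (z - x)) \<partial>?M)"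
        by (rule integral_mult_right_zero)
      finally show "(\<integral>z. 2 * z / ((z - y) * (z - x)) \<partial>?M) = (?f y - ?f x) / (y - x)"
        using y by simp
    qed
    ultimately show ?thesis
      unfolding has_field_derivative_iff by (rule Lim_transform_eventually)
  qed
  then show ?thesis
    unfolding holomorphic_on_def field_differentiable_def by blast
qed

lemma holomorphic_on_herglotz:
  assumes "psd_measure (sphere 0 1) \<mu>"
  shows "(\<lambda>\<zeta>. herglotz \<mu> \<zeta> $ i $ j) holomorphic_on ball 0 1"
  unfolding herglotz_def complex_mat_integral_def vec_lambda_beta
  by (intro holomorphic_intros holomorphic_on_herglotz_integral assms)


section \<open>The Cayley transform\<close>

lemma upper_half_plane_plus_i_nonzero: "w \<in> upper_half_plane \<Longrightarrow> w + \<i> \<noteq> 0"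
  by (auto simp: upper_half_plane_def complex_eq_iff)

lemma of_real_plus_i_nonzero: "complex_of_real t + \<i> \<noteq> 0"
  by (auto simp: complex_eq_iff)

text \<open>Rests on \<open>|w + \<i>|^2 - |w - \<i>|^2 = 4 * Im w\<close>. It locates the images of
  the half-plane and of the line, and it measures how fast \<open>cayley w\<close> approaches the
  circle, which the sector estimate needs.\<close>

lemma one_minus_norm_cayley:
  assumes "w + \<i> \<noteq> 0"
  shows "1 - (norm (cayley w))\<^sup>2 = 4 * Im w / (norm (w + \<i>))\<^sup>2"
proof -
  have "(norm (w + \<i>))\<^sup>2 - (norm (w - \<i>))\<^sup>2 = 4 * Im w"
    unfolding cmod_power2 by (simp add: power2_eq_square algebra_simps)
  moreover have "(norm (w + \<i>))\<^sup>2 \<noteq> 0"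
    using assms by simp
  ultimately show ?thesis
    unfolding cayley_def norm_divide power_divide by (metis diff_divide_distrib divide_self)
qed

lemma norm_cayley_less_1:
  assumes "w \<in> upper_half_plane" shows "norm (cayley w) < 1"
proof -
  have "0 < 1 - (norm (cayley w))\<^sup>2"
    using assms upper_half_plane_plus_i_nonzero[OF assms]
    by (simp add: one_minus_norm_cayley upper_half_plane_def)
  then show ?thesis
    using power2_less_imp_less[of "norm (cayley w)" 1] by simp
qed

lemma norm_cayley_of_real: "norm (cayley (complex_of_real t)) = 1"
proof -
  have "(norm (cayley (complex_of_real t)))\<^sup>2 = 1"
    using one_minus_norm_cayley[OF of_real_plus_i_nonzero, of t] by simp
  then show ?thesis by (simp add: power2_eq_1_iff) (smt (verit) norm_ge_zero)
qed

lemma inverse_cayley_cayley: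
  assumes "w + \<i> \<noteq> 0" shows "\<i> * (1 + cayley w) / (1 - cayley w) = w"
proof -
  have "1 + cayley w = 2 * w / (w + \<i>)" "1 - cayley w = 2 * \<i> / (w + \<i>)"
    using assms by (simp_all add: cayley_def field_simps)
  then show ?thesis using assms by simp
qed

lemma cayley_inverse_cayley:
  assumes "\<zeta> \<noteq> 1" shows "cayley (\<i> * (1 + \<zeta>) / (1 - \<zeta>)) = \<zeta>"
proof -
  have "\<i> * (1 + \<zeta>) / (1 - \<zeta>) - \<i> = 2 * \<i> * \<zeta> / (1 - \<zeta>)" "\<i> * (1 + \<zeta>) / (1 - \<zeta>) + \<i> = 2 * \<i> / (1 - \<zeta>)"
    using assms by (simp_all add: field_simps)
  then show ?thesis using assms by (simp add: cayley_def)
qed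

text \<open>The inverse Cayley transform is \<open>\<i>\<close> times the Herglotz kernel at the
  boundary point 1, so its imaginary part is the Poisson kernel there.\<close>

lemma Im_inverse_cayley: "Im (\<i> * (1 + \<zeta>) / (1 - \<zeta>)) = (1 - (norm \<zeta>)\<^sup>2) / (norm (1 - \<zeta>))\<^sup>2"
  using Re_herglotz_kernel[of 1 \<zeta>]
  by (simp only: norm_one times_divide_eq_right[symmetric] Im_i_times)

lemma inverse_cayley_in_upper_half_plane:
  assumes "norm \<zeta> < 1" shows "\<i> * (1 + \<zeta>) / (1 - \<zeta>) \<in> upper_half_plane"
proof -
  have "(norm \<zeta>)\<^sup>2 < 1" using assms by (simp add: power_less_one_iff abs_square_less_1)
  moreover have "\<zeta> \<noteq> 1" using assms by auto
  ultimately show ?thesis unfolding upper_half_plane_def mem_Collect_eq Im_inverse_cayley by simp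
qed

lemma inj_on_cayley: "inj_on cayley {w. w + \<i> \<noteq> 0}"
  by (rule inj_on_inverseI[where g = "\<lambda>\<zeta>. \<i> * (1 + \<zeta>) / (1 - \<zeta>)"]) (simp add: inverse_cayley_cayley)

text \<open>Injectivity of \<open>cayley\<close> replaces the choice in \<open>inv_into\<close> by
  the explicit Moebius inverse, which makes the analyticity of \<open>disk_fun B\<close>
  accessible.\<close>

lemma disk_fun_eq:
  assumes "norm \<zeta> < 1" shows "disk_fun B \<zeta> = B (\<i> * (1 + \<zeta>) / (1 - \<zeta>))"
proof -
  have "inv_into upper_half_plane cayley (cayley w) = w" if "w \<in> upper_half_plane" for w
    using that by (intro inv_into_f_f inj_on_subset[OF inj_on_cayley])
      (auto dest: upper_half_plane_plus_i_nonzero)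
  moreover have "\<zeta> \<noteq> 1" using assms by auto
  ultimately show ?thesis
    unfolding disk_fun_def
    using inverse_cayley_in_upper_half_plane[OF assms] by (metis cayley_inverse_cayley)
qed

lemma disk_fun_cayley:
  assumes "w \<in> upper_half_plane" shows "disk_fun B (cayley w) = B w"
  by (simp add: disk_fun_eq norm_cayley_less_1 assms
      inverse_cayley_cayley[OF upper_half_plane_plus_i_nonzero[OF assms]])

lemma holomorphic_on_disk_fun:
  assumes "B \<in> schur_class upper_half_plane"
  shows "(\<lambda>\<zeta>. disk_fun B \<zeta> $ i $ j) holomorphic_on ball 0 1"
proof -
  have "(\<lambda>\<zeta>. \<i> * (1 + \<zeta>) / (1 - \<zeta>)) holomorphic_on ball 0 1"
    by (intro holomorphic_intros) auto
  moreover have "(\<lambda>w. B w $ i $ j) holomorphic_on upper_half_plane"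
    using assms by (simp add: schur_class_def)
  ultimately have "((\<lambda>w. B w $ i $ j) \<circ> (\<lambda>\<zeta>. \<i> * (1 + \<zeta>) / (1 - \<zeta>))) holomorphic_on ball 0 1"
    by (rule holomorphic_on_compose_gen) (use inverse_cayley_in_upper_half_plane in auto)
  then show ?thesis
    by (rule holomorphic_transform) (simp add: disk_fun_eq)
qed

section \<open>Transport of the measure from the circle to the line\<close>

text \<open>On the circle the inverse transform has imaginary part 0 because
  \<open>1 - (norm z)\<^sup>2 = 0\<close>. As a preimage condition the image is visibly Borel, and
  disjoint sets have disjoint images. The point 1 is excluded explicitly: division by zero would
  send it to 0 and so place it in the image whenever \<open>0 \<in> A\<close>.\<close>

lemma cayley_image_real:
  "cayley ` complex_of_real ` A
    = {z \<in> sphere 0 1. z \<noteq> 1 \<and> Re (\<i> * (1 + z) / (1 - z)) \<in> A}"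
proof (intro set_eqI iffI)
  fix z assume "z \<in> cayley ` complex_of_real ` A"
  then obtain t where t: "t \<in> A" "z = cayley (complex_of_real t)" by blast
  then have "\<i> * (1 + z) / (1 - z) = of_real t"
    by (simp add: inverse_cayley_cayley of_real_plus_i_nonzero)
  moreover have "z \<noteq> 1"
    using of_real_plus_i_nonzero[of t] unfolding t cayley_def
    by (simp add: divide_eq_1_iff)
  ultimately show "z \<in> {z \<in> sphere 0 1. z \<noteq> 1 \<and> Re (\<i> * (1 + z) / (1 - z)) \<in> A}"
    using t by (simp add: norm_cayley_of_real del: Re_divide)
next
  fix z assume z: "z \<in> {z \<in> sphere 0 1. z \<noteq> 1 \<and> Re (\<i> * (1 + z) / (1 - z)) \<in> A}"
  then have "Im (\<i> * (1 + z) / (1 - z)) = 0"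
    unfolding Im_inverse_cayley by simp
  then have "\<i> * (1 + z) / (1 - z) = of_real (Re (\<i> * (1 + z) / (1 - z)))"
    by (metis complex_is_Real_iff of_real_Re)
  then have "z = cayley (of_real (Re (\<i> * (1 + z) / (1 - z))))"
    using z by (metis (mono_tags, lifting) cayley_inverse_cayley mem_Collect_eq)
  then show "z \<in> cayley ` complex_of_real ` A" using z by blast
qed

lemma cayley_image_real_measurable:
  assumes [measurable]: "A \<in> sets borel"
  shows "cayley ` complex_of_real ` A \<in> sets (restrict_space borel (sphere 0 1))"
proof -
  have "{z \<in> sphere 0 1. z \<noteq> 1 \<and> Re (\<i> * (1 + z) / (1 - z)) \<in> A}
      = sphere 0 1 \<inter> ({z. z \<noteq> 1} \<inter> (\<lambda>z. Re (\<i> * (1 + z) / (1 - z))) -` A)"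
    by auto
  moreover have "{z::complex. z \<noteq> 1} \<inter> (\<lambda>z. Re (\<i> * (1 + z) / (1 - z))) -` A \<in> sets borel"
  proof (rule sets.Int)
    show "{z::complex. z \<noteq> 1} \<in> sets borel" by measurable
    have "(\<lambda>z::complex. Re (\<i> * (1 + z) / (1 - z))) \<in> borel_measurable borel" by measurable
    from measurable_sets[OF this assms]
    show "(\<lambda>z. Re (\<i> * (1 + z) / (1 - z))) -` A \<in> sets borel" by simp
  qed
  ultimately show ?thesis
    unfolding cayley_image_real sets_restrict_space by blast
qed

lemma psd_measure_cayley_pullback:
  assumes \<mu>: "psd_measure (sphere 0 1) \<mu>"
  shows "psd_measure UNIV (\<lambda>A. \<mu> (cayley ` complex_of_real ` A))"
  unfolding psd_measure_def
proof (intro conjI ballI allI impI)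
  fix A :: "real set" assume "A \<in> sets (restrict_space borel UNIV)"
  then have "A \<in> sets borel"
    by (simp add: sets_restrict_space)
  then show "psd (\<mu> (cayley ` complex_of_real ` A))"
    using \<mu> cayley_image_real_measurable[of A] unfolding psd_measure_def by blast
next
  fix A :: "nat \<Rightarrow> real set"
  assume A: "range A \<subseteq> sets (restrict_space borel UNIV) \<and> disjoint_family A"
  let ?A = "\<lambda>k. cayley ` complex_of_real ` A k"
  have "?A k \<in> sets (restrict_space borel (sphere 0 1))" for k
    using A by (intro cayley_image_real_measurable) (auto simp: sets_restrict_space)
  then have "range ?A \<subseteq> sets (restrict_space borel (sphere 0 1))"
    by blast
  moreover have "disjoint_family ?A"
    using A unfolding disjoint_family_on_def cayley_image_real by blast
  ultimately have "(\<lambda>k. \<mu> (?A k)) sums \<mu> (\<Union>k. ?A k)"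
    using \<mu> unfolding psd_measure_def by blast
  then show "(\<lambda>k. \<mu> (?A k)) sums \<mu> (cayley ` complex_of_real ` (\<Union>k. A k))"
    by (simp add: image_UN)
qed

lemma line_clark_measure_singleton:
  assumes "psd_measure (sphere 0 1) \<mu>"
  shows "line_clark_measure \<mu> {s} $ i $ j
    = complex_of_real (1 / (pi * (1 + s\<^sup>2))) * \<mu> {cayley (complex_of_real s)} $ i $ j"
  unfolding line_clark_measure_def
  by (subst mat_integral_singleton[OF psd_measure_cayley_pullback[OF assms]]) simp_all


section \<open>Nontangential limits of the Herglotz integral\<close>

text \<open>Here the aperture of the sector matters: it gives
  \<open>norm (s - w) \<le> (\<kappa> + 1) * Im w\<close>, while the kernel is at most
  \<open>(norm (w + \<i>))\<^sup>2 / Im w\<close>. The factor \<open>Im w\<close> cancels, leaving a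
  bound uniform in \<open>z\<close>.\<close>

lemma sector_herglotz_kernel_le:
  assumes w: "w \<in> stolz_sector s \<kappa>" and z: "norm z = 1"
  shows "norm ((s - w) * ((z + cayley w) / (z - cayley w))) \<le> (\<kappa> + 1) * (norm (w + \<i>))\<^sup>2"
proof -
  have Im: "Im w > 0" and Re: "\<bar>Re w - s\<bar> < \<kappa> * Im w"
    using w by (auto simp: stolz_sector_def)
  have wi: "w + \<i> \<noteq> 0" and less1: "norm (cayley w) < 1"
    using Im upper_half_plane_plus_i_nonzero norm_cayley_less_1 by (auto simp: upper_half_plane_def)
  have "norm (s - w) \<le> \<bar>Re w - s\<bar> + Im w"
    using cmod_le[of "s - w"] Im by (simp add: abs_minus_commute)
  then have sw: "norm (s - w) \<le> (\<kappa> + 1) * Im w"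
    using Re by (simp add: algebra_simps)
  \<comment> \<open>Turns the exact formula for \<open>1 - (norm (cayley w))\<^sup>2\<close> into a
    lower bound for \<open>1 - norm (cayley w)\<close>.\<close>
  have "(1 - norm (cayley w)) * (1 + norm (cayley w)) \<le> (1 - norm (cayley w)) * 2"
    using less1 by (intro mult_left_mono) auto
  then have "4 * Im w / (norm (w + \<i>))\<^sup>2 \<le> (1 - norm (cayley w)) * 2"
    unfolding one_minus_norm_cayley[OF wi, symmetric] by (simp add: power2_eq_square algebra_simps)
  then have low: "2 * Im w / (norm (w + \<i>))\<^sup>2 \<le> 1 - norm (cayley w)"
    by simp
  have "norm ((z + cayley w) / (z - cayley w)) \<le> 2 / (1 - norm (cayley w))"
    by (rule norm_herglotz_kernel_le[OF z less1])
  also have "\<dots> \<le> 2 / (2 * Im w / (norm (w + \<i>))\<^sup>2)"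
    using low Im wi by (intro divide_left_mono) (auto intro!: mult_pos_pos divide_pos_pos simp: less1)
  also have "\<dots> = (norm (w + \<i>))\<^sup>2 / Im w"
    by simp
  finally have "norm (s - w) * norm ((z + cayley w) / (z - cayley w))
      \<le> ((\<kappa> + 1) * Im w) * ((norm (w + \<i>))\<^sup>2 / Im w)"
    using sw by (intro mult_mono) (auto intro: order_trans[OF norm_ge_zero sw])
  then show ?thesis
    using Im unfolding norm_mult[of "s - w"] by simp
qed

lemma tendsto_cayley: "(cayley \<longlongrightarrow> cayley (complex_of_real s)) (at (complex_of_real s) within S)"
  unfolding cayley_def[abs_def] by (intro tendsto_intros of_real_plus_i_nonzero)

lemma tendsto_const_minus_ident: "((\<lambda>w. a - w) \<longlongrightarrow> 0) (at a within S)"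
  for a :: "'a::real_normed_vector"
  using tendsto_diff[OF tendsto_const tendsto_ident_at, of a a S] by simp

text \<open>Away from \<open>\<xi>\<close> the denominator has a nonzero limit, so the factor
  \<open>s - w\<close> wins. At \<open>\<xi>\<close> that factor cancels against the simple zero of
  \<open>\<xi> - cayley w\<close>. The indicator form lets the limit integral produce a point
  mass.\<close>

lemma sector_herglotz_kernel_tendsto:
  fixes s :: real
  defines "\<xi> \<equiv> cayley (complex_of_real s)"
  shows "((\<lambda>w. (s - w) * ((z + cayley w) / (z - cayley w)))
    \<longlongrightarrow> indicator {\<xi>} z *\<^sub>R (- \<i> * (1 + (complex_of_real s)\<^sup>2))) (at (complex_of_real s) within stolz_sector s \<kappa>)"
proof (cases "z = \<xi>")
  case False
  have "((\<lambda>w. (s - w) * ((z + cayley w) / (z - cayley w)))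
      \<longlongrightarrow> 0 * ((z + \<xi>) / (z - \<xi>))) (at (complex_of_real s) within stolz_sector s \<kappa>)"
    using False unfolding \<xi>_def
    by (intro tendsto_mult tendsto_divide tendsto_add tendsto_diff tendsto_const tendsto_cayley
        tendsto_const_minus_ident) auto
  then show ?thesis using False by simp
next
  case True
  have lim: "(\<xi> + \<xi>) * ((s + \<i>) * (s + \<i>) / (2 * \<i>)) = - \<i> * (1 + (complex_of_real s)\<^sup>2)"
  proof -
    have "\<xi> * (s + \<i>) = s - \<i>"
      using of_real_plus_i_nonzero[of s] by (simp add: \<xi>_def cayley_def)
    moreover have "(\<xi> + \<xi>) * ((s + \<i>) * (s + \<i>) / (2 * \<i>)) = \<xi> * (s + \<i>) * (s + \<i>) / \<i>"
      by (simp add: field_simps)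
    ultimately have "(\<xi> + \<xi>) * ((s + \<i>) * (s + \<i>) / (2 * \<i>)) = (s - \<i>) * (s + \<i>) / \<i>"
      by (simp only:)
    also have "\<dots> = - \<i> * (1 + (complex_of_real s)\<^sup>2)"
      by (simp add: field_simps power2_eq_square)
    finally show ?thesis .
  qed
  have "((\<lambda>w. (\<xi> + cayley w) * ((s + \<i>) * (w + \<i>) / (2 * \<i>)))
      \<longlongrightarrow> (\<xi> + \<xi>) * ((s + \<i>) * (s + \<i>) / (2 * \<i>))) (at (complex_of_real s) within stolz_sector s \<kappa>)"
    unfolding \<xi>_def by (intro tendsto_intros tendsto_cayley) auto
  moreover have "\<forall>\<^sub>F w in at (complex_of_real s) within stolz_sector s \<kappa>.
      (\<xi> + cayley w) * ((s + \<i>) * (w + \<i>) / (2 * \<i>)) = (s - w) * ((z + cayley w) / (z - cayley w))"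
    unfolding eventually_at_filter
  proof (intro always_eventually allI impI)
    fix w assume w: "w \<noteq> complex_of_real s" "w \<in> stolz_sector s \<kappa>"
    then have "w + \<i> \<noteq> 0"
      by (intro upper_half_plane_plus_i_nonzero) (simp add: stolz_sector_def upper_half_plane_def)
    \<comment> \<open>The zero of the denominator at \<open>w = s\<close> in explicit form; dividing
      it out gives the continuous expression whose limit was computed above.\<close>
    then have "\<xi> - cayley w = 2 * \<i> * (s - w) / ((s + \<i>) * (w + \<i>))"
      using of_real_plus_i_nonzero[of s] by (simp add: \<xi>_def cayley_def field_simps)
    then show "(\<xi> + cayley w) * ((s + \<i>) * (w + \<i>) / (2 * \<i>))
        = (s - w) * ((z + cayley w) / (z - cayley w))"
      using w True by simp
  qed
  ultimately show ?thesis
    using True unfolding lim by (simp add: Lim_transform_eventually)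
qed

text \<open>Bounded convergence is applied to each scalar form measure, where the limit integrand
  lives on the single point \<open>\<xi>\<close>. The resulting values
  \<open>qform (\<mu> {\<xi>}) v\<close> are then recombined by polarization.\<close>

lemma herglotz_nontangential_limit:
  fixes \<mu> :: "complex set \<Rightarrow> complex^'n^'n"
  assumes \<mu>: "psd_measure (sphere 0 1) \<mu>"
  shows "((\<lambda>w. (s - w) * herglotz \<mu> (cayley w) $ i $ j)
    \<longlongrightarrow> - \<i> * (1 + (complex_of_real s)\<^sup>2) * \<mu> {cayley (complex_of_real s)} $ i $ j)
    (at (complex_of_real s) within stolz_sector s \<kappa>)"
proof -
  define \<xi> where "\<xi> = cayley (complex_of_real s)"
  have \<xi>: "\<xi> \<in> sphere 0 1" by (simp add: \<xi>_def norm_cayley_of_real)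
  let ?F = "at (complex_of_real s) within stolz_sector s \<kappa>"
  have lim: "((\<lambda>w. (s - w) * (\<integral>z. (z + cayley w) / (z - cayley w) \<partial>form_measure (sphere 0 1) \<mu> v))
      \<longlongrightarrow> - \<i> * (1 + (complex_of_real s)\<^sup>2) * qform (\<mu> {\<xi>}) v) ?F" for v
  proof -
    let ?M = "form_measure (sphere 0 1) \<mu> v"
    interpret finite_measure ?M
      by (rule finite_measure_form_measure[OF \<mu>])
    have "((\<lambda>w. \<integral>z. (s - w) * ((z + cayley w) / (z - cayley w)) \<partial>?M)
        \<longlongrightarrow> (\<integral>z. indicator {\<xi>} z *\<^sub>R (- \<i> * (1 + (complex_of_real s)\<^sup>2)) \<partial>?M)) ?F"
    proof (rule integral_tendsto_bounded)
      \<comment> \<open>The sector bound still depends on \<open>w\<close> through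
        \<open>norm (w + \<i>)\<close>; by continuity its square stays below the value at
        \<open>s\<close> plus 1.\<close>
      let ?C = "(\<kappa> + 1) * ((norm (complex_of_real s + \<i>))\<^sup>2 + 1)"
      have "((\<lambda>w. (norm (w + \<i>))\<^sup>2) \<longlongrightarrow> (norm (complex_of_real s + \<i>))\<^sup>2) ?F"
        by (intro tendsto_intros)
      then have "\<forall>\<^sub>F w in ?F. (norm (w + \<i>))\<^sup>2 < (norm (complex_of_real s + \<i>))\<^sup>2 + 1"
        by (rule order_tendstoD) simp
      moreover have "\<forall>\<^sub>F w in ?F. w \<in> stolz_sector s \<kappa>"
        by (simp add: eventually_at_filter)
      ultimately show "\<forall>\<^sub>F w in ?F. \<forall>z\<in>space ?M.
          norm ((s - w) * ((z + cayley w) / (z - cayley w))) \<le> ?C"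
      proof eventually_elim
        case (elim w)
        \<comment> \<open>Any point of the sector forces \<open>\<kappa> > 0\<close>, so the factor
          \<open>\<kappa> + 1\<close> preserves the inequality.\<close>
        from elim(2) have "0 < \<kappa> * Im w" "0 < Im w" by (auto simp: stolz_sector_def)
        then have "0 < \<kappa>" by (simp add: zero_less_mult_iff)
        with elim(1) have "(\<kappa> + 1) * (norm (w + \<i>))\<^sup>2 \<le> ?C"
          by (intro mult_left_mono) auto
        then show ?case
          using sector_herglotz_kernel_le[OF elim(2)]
          by (intro ballI order_trans[OF _ \<open>(\<kappa> + 1) * (norm (w + \<i>))\<^sup>2 \<le> ?C\<close>]) simp
      qed
    qed (use sector_herglotz_kernel_tendsto in \<open>auto simp: \<xi>_def\<close>)
    moreover have "(\<integral>z. indicator {\<xi>} z *\<^sub>R (- \<i> * (1 + (complex_of_real s)\<^sup>2)) \<partial>?M)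
        = - \<i> * (1 + (complex_of_real s)\<^sup>2) * qform (\<mu> {\<xi>}) v"
    proof -
      have "{\<xi>} \<in> sets ?M"
        using singleton_in_sets_restrict_borel[OF \<xi>] by (simp add: sets_form_measure)
      then have "(\<integral>z. indicator {\<xi>} z *\<^sub>R (- \<i> * (1 + (complex_of_real s)\<^sup>2)) \<partial>?M)
          = measure ?M {\<xi>} *\<^sub>R (- \<i> * (1 + (complex_of_real s)\<^sup>2))"
        by (intro has_bochner_integral_integral_eq has_bochner_integral_indicator)
           (simp_all add: less_top[symmetric])
      then show ?thesis
        by (simp add: scaleR_conv_of_real measure_form_measure_singleton[OF \<mu> \<xi>] mult_ac)
    qed
    ultimately show ?thesis by (simp only: integral_mult_right_zero)
  qed
  have "((\<lambda>w. 1/4 * (\<Sum>k<4. (-\<i>)^k * ((s - w) *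
        (\<integral>z. (z + cayley w) / (z - cayley w)
          \<partial>form_measure (sphere 0 1) \<mu> (axis i 1 + \<i>^k *s axis j 1)))))
      \<longlongrightarrow> 1/4 * (\<Sum>k<4. (-\<i>)^k *
        (- \<i> * (1 + (complex_of_real s)\<^sup>2) * qform (\<mu> {\<xi>}) (axis i 1 + \<i>^k *s axis j 1)))) ?F"
    by (intro tendsto_intros lim)
  moreover have "1/4 * (\<Sum>k<4. (-\<i>)^k *
        (- \<i> * (1 + (complex_of_real s)\<^sup>2) * qform (\<mu> {\<xi>}) (axis i 1 + \<i>^k *s axis j 1)))
      = - \<i> * (1 + (complex_of_real s)\<^sup>2) * \<mu> {\<xi>} $ i $ j"
    unfolding qform_polarization[of "\<mu> {\<xi>}" i j, symmetric] sum_distrib_left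
    by (intro sum.cong refl) (simp add: mult_ac)
  moreover have "1/4 * (\<Sum>k<4. (-\<i>)^k * ((s - w) *
        (\<integral>z. (z + cayley w) / (z - cayley w)
          \<partial>form_measure (sphere 0 1) \<mu> (axis i 1 + \<i>^k *s axis j 1))))
      = (s - w) * herglotz \<mu> (cayley w) $ i $ j" for w :: complex
    unfolding herglotz_def complex_mat_integral_def vec_lambda_beta sum_distrib_left
    by (intro sum.cong refl) (simp add: mult_ac)
  ultimately show ?thesis
    unfolding \<xi>_def[symmetric] by (simp only:)
qed


section \<open>Point masses of the Clark measure\<close>

lemma clark_measure_herglotz_representation:
  fixes b :: "complex \<Rightarrow> complex^'n^'n"
  assumes b: "\<And>i j. (\<lambda>\<zeta>. b \<zeta> $ i $ j) holomorphic_on ball 0 1"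
    and inv: "\<forall>\<zeta>\<in>ball 0 1. invertible (mat 1 - b \<zeta> ** adj \<alpha>)"
    and clark: "is_clark_measure b \<alpha> \<mu>"
  shows "\<exists>C. \<forall>\<zeta>\<in>ball 0 1. \<forall>i j.
    matrix_inv (mat 1 - b \<zeta> ** adj \<alpha>) $ i $ j = herglotz \<mu> \<zeta> $ i $ j / 2 + C $ i $ j"
proof -
  have \<mu>: "psd_measure (sphere 0 1) \<mu>"
    using clark by (simp add: is_clark_measure_def)
  define H where "H \<zeta> = matrix_inv (mat 1 - b \<zeta> ** adj \<alpha>) ** (mat 1 + b \<zeta> ** adj \<alpha>)" for \<zeta>
  have H: "H \<zeta> $ i $ j = 2 * matrix_inv (mat 1 - b \<zeta> ** adj \<alpha>) $ i $ j - mat 1 $ i $ j"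
    if "\<zeta> \<in> ball 0 1" for \<zeta> i j
    unfolding H_def using inv that by (intro matrix_inv_Cayley) auto
  have "(\<lambda>\<zeta>. (mat 1 - b \<zeta> ** adj \<alpha>) $ i $ j) holomorphic_on ball 0 1" for i j
    unfolding vector_minus_component by (intro holomorphic_intros holomorphic_on_matrix_mult_const b)
  then have "(\<lambda>\<zeta>. 2 * matrix_inv (mat 1 - b \<zeta> ** adj \<alpha>) $ i $ j - mat 1 $ i $ j) holomorphic_on ball 0 1"
    for i j
    using inv by (intro holomorphic_intros holomorphic_on_matrix_inv) auto
  then have holo: "(\<lambda>\<zeta>. H \<zeta> $ i $ j) holomorphic_on ball 0 1" for i j
    by (rule holomorphic_transform) (simp add: H)
  have "\<exists>C. \<forall>\<zeta>\<in>ball 0 1. H \<zeta> - herglotz \<mu> \<zeta> = C"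
  proof (rule re_mat_0_imp_constant)
    show "(\<lambda>\<zeta>. (H \<zeta> - herglotz \<mu> \<zeta>) $ i $ j) holomorphic_on ball 0 1" for i j
      unfolding vector_minus_component by (intro holomorphic_intros holo holomorphic_on_herglotz \<mu>)
    fix \<zeta> :: complex assume \<zeta>: "\<zeta> \<in> ball 0 1"
    then have "re_mat (H \<zeta>) = re_mat (herglotz \<mu> \<zeta>)"
      using clark by (simp add: re_mat_herglotz[OF \<mu>] H_def is_clark_measure_def)
    then show "re_mat (H \<zeta> - herglotz \<mu> \<zeta>) = 0"
      by (simp add: vec_eq_iff re_mat_nth add_divide_distrib diff_divide_distrib algebra_simps)
  qed auto
  then obtain C where C: "\<And>\<zeta>. \<zeta> \<in> ball 0 1 \<Longrightarrow> H \<zeta> - herglotz \<mu> \<zeta> = C" by blast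
  show ?thesis
  \<comment> \<open>The witness solves \<open>2 * V - 1 = G + C\<close> for the resolvent
    \<open>V\<close>, where \<open>G\<close> is the Herglotz integral and \<open>C\<close> the
    constant difference.\<close>
  proof (intro exI[of _ "\<chi> i j. (C $ i $ j + mat 1 $ i $ j) / 2"] ballI allI)
    fix \<zeta> :: complex and i j assume \<zeta>: "\<zeta> \<in> ball 0 1"
    have "H \<zeta> $ i $ j - herglotz \<mu> \<zeta> $ i $ j = C $ i $ j"
      using C[OF \<zeta>] by auto
    then show "matrix_inv (mat 1 - b \<zeta> ** adj \<alpha>) $ i $ j
      = herglotz \<mu> \<zeta> $ i $ j / 2 + (\<chi> i j. (C $ i $ j + mat 1 $ i $ j) / 2) $ i $ j"
      unfolding H[OF \<zeta>] by (simp add: field_simps)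
  qed
qed

theorem theorem7:
  fixes B :: "complex \<Rightarrow> complex^'n^'n" and \<alpha> :: "complex^'n^'n"
    and \<mu> :: "complex set \<Rightarrow> complex^'n^'n" and s :: real
  assumes "B \<in> schur_class upper_half_plane"
    and "unitary_mat \<alpha>"
    and "\<forall>\<zeta>\<in>ball 0 1. invertible (mat 1 - disk_fun B \<zeta> ** adj \<alpha>)"
    and "is_clark_measure (disk_fun B) \<alpha> \<mu>"
  shows "\<exists>L. nontangential_limit
               (\<lambda>w. cscale (complex_of_real s - w) (matrix_inv (mat 1 - B w ** adj \<alpha>))) s L
           \<and> line_clark_measure \<mu> {s} = cscale (2 * \<i> / (pi * (1 + s\<^sup>2)\<^sup>2)) L"
proof -
  have \<mu>: "psd_measure (sphere 0 1) \<mu>"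
    using assms by (simp add: is_clark_measure_def)
  obtain C where C: "\<And>\<zeta> i j. \<zeta> \<in> ball 0 1 \<Longrightarrow>
      matrix_inv (mat 1 - disk_fun B \<zeta> ** adj \<alpha>) $ i $ j = herglotz \<mu> \<zeta> $ i $ j / 2 + C $ i $ j"
    using clark_measure_herglotz_representation[OF holomorphic_on_disk_fun[OF assms(1)] assms(3,4)]
    by blast
  \<comment> \<open>Half the limit of the Herglotz integral, since the resolvent is half that
    integral plus a constant.\<close>
  let ?L = "cscale (- \<i> * (1 + (complex_of_real s)\<^sup>2) / 2) (\<mu> {cayley (complex_of_real s)})"
  have "((\<lambda>w. cscale (s - w) (matrix_inv (mat 1 - B w ** adj \<alpha>))) \<longlongrightarrow> ?L)
      (at (complex_of_real s) within stolz_sector s \<kappa>)" for \<kappa>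
  proof (rule tendsto_matrixI)
    fix i j
    let ?F = "at (complex_of_real s) within stolz_sector s \<kappa>"
    have "((\<lambda>w. ((s - w) * herglotz \<mu> (cayley w) $ i $ j) / 2 + (s - w) * C $ i $ j)
        \<longlongrightarrow> (- \<i> * (1 + (complex_of_real s)\<^sup>2) * \<mu> {cayley (complex_of_real s)} $ i $ j) / 2 + 0 * C $ i $ j) ?F"
      by (intro tendsto_add tendsto_divide tendsto_const herglotz_nontangential_limit \<mu>
          tendsto_mult[OF tendsto_const_minus_ident]) simp
    moreover have "\<forall>\<^sub>F w in ?F. ((s - w) * herglotz \<mu> (cayley w) $ i $ j) / 2 + (s - w) * C $ i $ j
        = cscale (s - w) (matrix_inv (mat 1 - B w ** adj \<alpha>)) $ i $ j"
      unfolding eventually_at_filter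
    proof (intro always_eventually allI impI)
      fix w assume "w \<in> stolz_sector s \<kappa>"
      then have w: "w \<in> upper_half_plane" by (simp add: stolz_sector_def upper_half_plane_def)
      have "matrix_inv (mat 1 - B w ** adj \<alpha>) $ i $ j = herglotz \<mu> (cayley w) $ i $ j / 2 + C $ i $ j"
        using C[of "cayley w" i j] w by (simp add: norm_cayley_less_1 disk_fun_cayley)
      then show "((s - w) * herglotz \<mu> (cayley w) $ i $ j) / 2 + (s - w) * C $ i $ j
        = cscale (s - w) (matrix_inv (mat 1 - B w ** adj \<alpha>)) $ i $ j"
        by (simp add: cscale_nth distrib_left)
    qed
    ultimately show "((\<lambda>w. cscale (s - w) (matrix_inv (mat 1 - B w ** adj \<alpha>)) $ i $ j)
        \<longlongrightarrow> ?L $ i $ j) ?F"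
      by (simp add: cscale_nth Lim_transform_eventually)
  qed
  then have "nontangential_limit (\<lambda>w. cscale (s - w) (matrix_inv (mat 1 - B w ** adj \<alpha>))) s ?L"
    by (simp add: nontangential_limit_def)
  moreover have "line_clark_measure \<mu> {s} = cscale (2 * \<i> / (pi * (1 + s\<^sup>2)\<^sup>2)) ?L"
  proof -
    have "1 + s\<^sup>2 \<noteq> 0" by (smt (verit) zero_le_power2)
    then have "1 + (complex_of_real s)\<^sup>2 \<noteq> 0"
      by (metis of_real_1 of_real_add of_real_eq_0_iff of_real_power)
    \<comment> \<open>With \<open>c = 1 + s\<^sup>2\<close>, one power of \<open>c\<close> in the
      denominator cancels the factor from the kernel limit; the other is the density in the
      normalization on the line.\<close>
    moreover have "1 / (pi * c) = 2 * \<i> / (pi * c\<^sup>2) * (- \<i> * c / 2)" if "c \<noteq> 0" for c :: complex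
      using that by (simp add: divide_simps power2_eq_square)
    ultimately have "complex_of_real (1 / (pi * (1 + s\<^sup>2)))
        = 2 * \<i> / (pi * (1 + s\<^sup>2)\<^sup>2) * (- \<i> * (1 + (complex_of_real s)\<^sup>2) / 2)"
      unfolding of_real_divide of_real_mult of_real_add of_real_power of_real_1 by blast
    then show ?thesis
      unfolding vec_eq_iff cscale_nth line_clark_measure_singleton[OF \<mu>] by (auto simp only: mult.assoc)
  qed
  ultimately show ?thesis by blast
qed

end
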